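(* Set $$\lambda = (h_1 +h_2 -l_1-l_2 -\alpha _1-\alpha _2+1 )/2,\quad a=q^{\lambda + \alpha_1 }, \quad b= q^{\lambda + \alpha_1 +l_2 -h_2 }, \quad b'= q^{\lambda + \alpha_1 +l_1 -h_1 }.$$ If a function $f(x_1,x_2)$ satisfies the $q$-difference equation $$(aq x_1-b')(aq x_2-b)f(q^2 x_1,q^2 x_2 ) +q(x_1-1)(x_2 -1)f(x_1,x_2) -\big(aq(q+1)x_1 x_2 -q(a+b)x_1 -q(a+b')x_2 +b b' +q\big)f(qx_1,qx_2 ) = 0,$$ then the function $$g(x) = x ^{-\alpha_1 } f( q^{l_1+ 1/2} t_1 /x ,\ q^{l_2+ 1/2} t_2 /x )$$ satisfies the variant of the $q$-hypergeometric equation of degree two, i.e. $$(x-q^{h_1 +1/2} t_1) (x - q^{h_2 +1/2} t_2)\, g(x/q) + q^{\alpha _1 +\alpha _2} (x - q^{l_1-1/2}t_1 ) (x - q^{l_2 -1/2} t_2)\, g(q x) -\big[ (q^{\alpha _1} +q^{\alpha _2} ) x^2 +E x + p ( q^{1/2}+ q^{-1/2}) t_1 t_2 \big]\, g(x) =0,$$ where $p= q^{(h_1 +h_2 + l_1 + l_2 +\alpha _1 +\alpha _2 )/2 }$ and $E= -p \{ (q^{- h_2 }+q^{-l_2 })t_1 + (q^{- h_1 }+ q^{- l_1 }) t_2 \}$.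
   Context: Here $q$ is a fixed nonzero complex number with a fixed choice of $\log q$ so that $q^s=e^{s\log q}$; $h_1,h_2,l_1,l_2,\alpha_1,\alpha_2,t_1,t_2$ are complex parameters. The power $x^{s}$ satisfies $(q^{\pm1}x)^{s}=q^{\pm s}x^{s}$. *)

theory Defs
  imports Complex_Main
begin

text \<open>The chosen value of the logarithm of \<open>q\<close> is passed explicitly as \<open>lq\<close>, so that
  \<open>qpow lq s\<close> is \<open>q\<close> to the power \<open>s\<close> for the fixed choice of \<open>log q\<close>.\<close>

definition qpow :: "complex \<Rightarrow> complex \<Rightarrow> complex" where
  "qpow lq s = exp (s * lq)"

text \<open>The power \<open>x\<close> to the \<open>s\<close> is multivalued, and the principal branch \<open>x powr s\<close> is in general
  not compatible with multiplication of \<open>x\<close> by \<open>q\<close>. We therefore speak of a function \<open>\<phi>\<close> on a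
  set \<open>X\<close> which obeys the rule that the power obeys under multiplication of \<open>x\<close> by \<open>q\<close> and its
  inverse. Powers formed with a suitable branch of the logarithm are an
  instance, see below (where \<open>lg\<close> is that branch; \<open>exp (lg x) = x\<close> is not needed for the rule).\<close>

definition is_q_power :: "complex \<Rightarrow> complex \<Rightarrow> complex set \<Rightarrow> (complex \<Rightarrow> complex) \<Rightarrow> bool" where
  "is_q_power lq s X \<phi> \<longleftrightarrow>
     (\<forall>x\<in>X. \<phi> (qpow lq 1 * x) = qpow lq s * \<phi> x \<and>
            \<phi> (qpow lq (-1) * x) = qpow lq (- s) * \<phi> x)"

lemma is_q_power_exp_log:
  assumes 1: "\<And>x. x \<in> X \<Longrightarrow> lg (exp lq * x) = lg x + lq"
    and 2: "\<And>x. x \<in> X \<Longrightarrow> lg (exp (- lq) * x) = lg x - lq"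
  shows "is_q_power lq s X (\<lambda>x. exp (s * lg x))"
  unfolding is_q_power_def qpow_def
proof (intro ballI conjI)
  fix x assume x: "x \<in> X"
  show "exp (s * lg (exp (1 * lq) * x)) = exp (s * lq) * exp (s * lg x)"
    using 1[OF x] by (simp add: exp_add [symmetric] algebra_simps)
  show "exp (s * lg (exp (- 1 * lq) * x)) = exp (- s * lq) * exp (s * lg x)"
    using 2[OF x] by (simp only: mult_minus1 exp_add [symmetric]) (simp add: algebra_simps)
qed

end

theory Submission
  imports Defs
begin

text \<open>Write \<open>y\<^sub>i = q\<^bsup>l\<^sub>i + 1/2\<^esup> t\<^sub>i / x\<close>. Replacing \<open>x\<close> by \<open>x / q\<close> or \<open>q x\<close> replaces \<open>(y\<^sub>1, y\<^sub>2)\<close>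
  by \<open>(q y\<^sub>1, q y\<^sub>2)\<close> or \<open>(y\<^sub>1 / q, y\<^sub>2 / q)\<close>, so the equation for \<open>g\<close> at \<open>x\<close> and the equation for
  \<open>f\<close> at \<open>(y\<^sub>1 / q, y\<^sub>2 / q)\<close> are linear relations between the same three values of \<open>f\<close>. They turn
  out to be proportional: the equation for \<open>g\<close> is the equation for \<open>f\<close> times the factor
  \<open>q\<^bsup>\<alpha>\<^sub>1\<^esup> x\<^sup>2 \<phi>(x) / (b b')\<close>.

  Comparing coefficients uses two kinds of input. The power \<open>\<phi>\<close> contributes \<open>q\<^bsup>\<alpha>\<^sub>1\<^esup>\<close> at \<open>x / q\<close> and
  \<open>q\<^bsup>-\<alpha>\<^sub>1\<^esup>\<close> at \<open>q x\<close>; everything else follows from multiplicative relations between powers of \<open>q\<close>.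
  The relation \<open>b b' q\<^bsup>\<alpha>\<^sub>2\<^esup> = q\<^bsup>\<alpha>\<^sub>1\<^esup> q\<close> carries the choice of \<open>\<lambda>\<close>: it balances the two outer
  coefficients. The relation \<open>b' q\<^bsup>h\<^sub>1 + 1/2\<^esup> = a q\<^bsup>l\<^sub>1 + 1/2\<^esup>\<close> (and its companion for \<open>b\<close>) puts the zeros
  of the leading coefficient in the right place.\<close>

lemma qpow_add: "qpow lq (r + s) = qpow lq r * qpow lq s"
  by (simp add: qpow_def exp_add distrib_right)

lemma qpow_nonzero [simp]: "qpow lq s \<noteq> 0"
  by (simp add: qpow_def)

text \<open>The identity behind the proportionality, with every power of \<open>q\<close> replaced by
  a letter, so that only polynomial algebra is left: \<open>c\<close> and \<open>d\<close> stand for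
  \<open>q\<^bsup>\<alpha>\<^sub>1\<^esup>\<close> and \<open>q\<^bsup>\<alpha>\<^sub>2\<^esup>\<close>; \<open>u\<^sub>i\<close>, \<open>v\<^sub>i\<close>, \<open>w\<^sub>i\<close> for \<open>q\<close> to the powers \<open>l\<^sub>i + 1/2\<close>, \<open>l\<^sub>i - 1/2\<close>,
  \<open>h\<^sub>i + 1/2\<close>; \<open>H\<^sub>i\<close>, \<open>L\<^sub>i\<close> for \<open>q\<^bsup>-h\<^sub>i\<^esup>\<close>, \<open>q\<^bsup>-l\<^sub>i\<^esup>\<close>; and \<open>r\<close>, \<open>s\<close> for \<open>q\<^bsup>1/2\<^esup>\<close>, \<open>q\<^bsup>-1/2\<^esup>\<close>.
  The point \<open>(z\<^sub>1, z\<^sub>2)\<close> is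
  \<open>(y\<^sub>1 / q, y\<^sub>2 / q)\<close>, and \<open>Fm\<close>, \<open>F0\<close>, \<open>Fp\<close> are the values of \<open>f\<close> at it, at \<open>q\<close> times it and at
  \<open>q\<^sup>2\<close> times it.\<close>

lemma degree_two_relation_proportional:
  fixes q :: "'a :: field"
  assumes nz: "q \<noteq> 0" "x \<noteq> 0" "b \<noteq> 0" "b' \<noteq> 0"
    and bal: "b * b' * d = c * q"
    and w: "b' * w1 = a * u1" "b * w2 = a * u2"
    and u: "u1 = q * v1" "u2 = q * v2"
    and lin1: "c * a * u1 = b * b' * (p * L2)" "c * b * u1 = b * b' * (p * H2)"
    and lin2: "c * a * u2 = b * b' * (p * L1)" "c * b' * u2 = b * b' * (p * H1)"
    and const: "c * a * u1 * u2 = b * b' * (p * r)" and r: "r = q * s"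
    and z: "z1 = v1 * t1 / x" "z2 = v2 * t2 / x"
    and eq: "(a * q * z1 - b') * (a * q * z2 - b) * Fp + q * (z1 - 1) * (z2 - 1) * Fm
        - (a * q * (q + 1) * z1 * z2 - q * (a + b) * z1 - q * (a + b') * z2 + b * b' + q) * F0 = 0"
  shows "c * (x - w1 * t1) * (x - w2 * t2) * Fp + d * (x - v1 * t1) * (x - v2 * t2) * Fm
        - ((c + d) * x^2 - p * ((H2 + L2) * t1 + (H1 + L1) * t2) * x + p * (r + s) * t1 * t2) * F0 = 0"
proof -
  have zx: "x * z1 = v1 * t1" "x * z2 = v2 * t2"
    using nz z by simp_all
  have "x * (a * q * z1 - b') = a * u1 * t1 - b' * x" "x * (a * q * z2 - b) = a * u2 * t2 - b * x"
    using zx u by algebra+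
  hence fac: "x * (a * q * z1 - b') = - b' * (x - w1 * t1)" "x * (a * q * z2 - b) = - b * (x - w2 * t2)"
    using w by algebra+
  have lead: "b * b' * (c * (x - w1 * t1) * (x - w2 * t2))
      = c * x^2 * ((a * q * z1 - b') * (a * q * z2 - b))"
    using fac by algebra
  have trail: "b * b' * (d * (x - v1 * t1) * (x - v2 * t2)) = c * x^2 * (q * (z1 - 1) * (z2 - 1))"
    using bal zx by algebra
  \<comment> \<open>The middle coefficient is compared one monomial in \<open>t\<^sub>1\<close>, \<open>t\<^sub>2\<close> at a time: \<open>bal\<close> gives the part
    free of both, \<open>lin1\<close> and \<open>lin2\<close> the linear ones, \<open>const\<close> the one in \<open>t\<^sub>1 t\<^sub>2\<close>.\<close>
  have sq: "b * b' * (c + d) = c * (b * b' + q)"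
    using bal by algebra
  have x1: "b * b' * (p * (H2 + L2) * t1 * x) = c * x^2 * (q * (a + b) * z1)"
    using lin1 zx(1) u(1) by algebra
  have x2: "b * b' * (p * (H1 + L1) * t2 * x) = c * x^2 * (q * (a + b') * z2)"
    using lin2 zx(2) u(2) by algebra
  have "q * (b * b' * (p * s)) = q * (c * a * u1 * v2)"
    using const r u by algebra
  hence s: "b * b' * (p * s) = c * a * u1 * v2"
    using nz by simp
  have x0: "b * b' * (p * (r + s) * t1 * t2) = c * x^2 * (a * q * (q + 1) * z1 * z2)"
    using const s zx u by algebra
  have mid: "b * b' * ((c + d) * x^2 - p * ((H2 + L2) * t1 + (H1 + L1) * t2) * x
        + p * (r + s) * t1 * t2)
      = c * x^2 * (a * q * (q + 1) * z1 * z2 - q * (a + b) * z1 - q * (a + b') * z2 + b * b' + q)"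
    using sq x1 x2 x0 by algebra
  have "b * b' * (c * (x - w1 * t1) * (x - w2 * t2) * Fp + d * (x - v1 * t1) * (x - v2 * t2) * Fm
        - ((c + d) * x^2 - p * ((H2 + L2) * t1 + (H1 + L1) * t2) * x + p * (r + s) * t1 * t2) * F0)
      = c * x^2 * ((a * q * z1 - b') * (a * q * z2 - b) * Fp + q * (z1 - 1) * (z2 - 1) * Fm
        - (a * q * (q + 1) * z1 * z2 - q * (a + b) * z1 - q * (a + b') * z2 + b * b' + q) * F0)"
    using lead trail mid by algebra
  thus ?thesis
    using eq nz by simp
qed

theorem proposition3p1:
  fixes q lq h1 h2 l1 l2 \<alpha>1 \<alpha>2 t1 t2 lam a b b' p E :: complex
    and f :: "complex \<Rightarrow> complex \<Rightarrow> complex"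
    and \<phi> g :: "complex \<Rightarrow> complex"
    and D :: "(complex \<times> complex) set" and X :: "complex set"
  assumes q_nonzero: "q \<noteq> 0" and log_q: "exp lq = q"
    and D_invariant: "\<And>x1 x2. (q * x1, q * x2) \<in> D \<longleftrightarrow> (x1, x2) \<in> D"
    and X_nonzero: "0 \<notin> X" and X_invariant: "\<And>x. q * x \<in> X \<longleftrightarrow> x \<in> X"
    and power: "is_q_power lq (- \<alpha>1) X \<phi>"
    and lam: "lam = (h1 + h2 - l1 - l2 - \<alpha>1 - \<alpha>2 + 1) / 2"
    and a: "a = qpow lq (lam + \<alpha>1)"
    and b: "b = qpow lq (lam + \<alpha>1 + l2 - h2)"
    and b': "b' = qpow lq (lam + \<alpha>1 + l1 - h1)"
    and f_eq: "\<And>x1 x2. (x1, x2) \<in> D \<Longrightarrow>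
        (a * q * x1 - b') * (a * q * x2 - b) * f (q^2 * x1) (q^2 * x2)
        + q * (x1 - 1) * (x2 - 1) * f x1 x2
        - (a * q * (q + 1) * x1 * x2 - q * (a + b) * x1 - q * (a + b') * x2 + b * b' + q)
            * f (q * x1) (q * x2) = 0"
    and g: "\<And>x. g x = \<phi> x * f (qpow lq (l1 + 1/2) * t1 / x) (qpow lq (l2 + 1/2) * t2 / x)"
    and p: "p = qpow lq ((h1 + h2 + l1 + l2 + \<alpha>1 + \<alpha>2) / 2)"
    and E: "E = - p * ((qpow lq (- h2) + qpow lq (- l2)) * t1
                     + (qpow lq (- h1) + qpow lq (- l1)) * t2)"
  shows "\<forall>x\<in>X. (qpow lq (l1 + 1/2) * t1 / x, qpow lq (l2 + 1/2) * t2 / x) \<in> D \<longrightarrow>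
        (x - qpow lq (h1 + 1/2) * t1) * (x - qpow lq (h2 + 1/2) * t2) * g (x / q)
        + qpow lq (\<alpha>1 + \<alpha>2) * (x - qpow lq (l1 - 1/2) * t1) * (x - qpow lq (l2 - 1/2) * t2)
            * g (q * x)
        - ((qpow lq \<alpha>1 + qpow lq \<alpha>2) * x^2 + E * x
            + p * (qpow lq (1/2) + qpow lq (- 1/2)) * t1 * t2) * g x = 0"
proof (intro ballI impI)
  fix x assume x: "x \<in> X" and D: "(qpow lq (l1 + 1/2) * t1 / x, qpow lq (l2 + 1/2) * t2 / x) \<in> D"
  have x0: "x \<noteq> 0"
    using x X_nonzero by auto
  have q1: "qpow lq 1 = q" "qpow lq (- 1) = 1 / q"
    using log_q by (simp_all add: qpow_def exp_minus field_simps)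
  have \<phi>: "\<phi> (x / q) = qpow lq \<alpha>1 * \<phi> x" "\<phi> (q * x) = qpow lq (- \<alpha>1) * \<phi> x"
    using power x by (simp_all add: is_q_power_def q1)
  have u: "qpow lq (l + 1/2) = q * qpow lq (l - 1/2)" for l
    using qpow_add[of lq 1 "l - 1/2"] by (simp add: q1 algebra_simps)
  define z1 z2 where z: "z1 = qpow lq (l1 - 1/2) * t1 / x" "z2 = qpow lq (l2 - 1/2) * t2 / x"
  have zD: "(z1, z2) \<in> D"
    using D D_invariant[of z1 z2] by (simp add: z u mult.assoc)
  have g_at: "g (x / q) = qpow lq \<alpha>1 * \<phi> x * f (q^2 * z1) (q^2 * z2)"
    "g (q * x) = qpow lq (- \<alpha>1) * \<phi> x * f z1 z2" "g x = \<phi> x * f (q * z1) (q * z2)"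
    using q_nonzero by (simp_all add: g \<phi> z u power2_eq_square mult_ac)
  have \<alpha>: "qpow lq (\<alpha>1 + \<alpha>2) * qpow lq (- \<alpha>1) = qpow lq \<alpha>2"
    by (simp flip: qpow_add)
  have qq: "q = qpow lq 1"
    by (simp add: q1)
  have rel: "qpow lq \<alpha>1 * (x - qpow lq (h1 + 1/2) * t1) * (x - qpow lq (h2 + 1/2) * t2)
          * f (q^2 * z1) (q^2 * z2)
        + qpow lq \<alpha>2 * (x - qpow lq (l1 - 1/2) * t1) * (x - qpow lq (l2 - 1/2) * t2) * f z1 z2
        - ((qpow lq \<alpha>1 + qpow lq \<alpha>2) * x^2
            - p * ((qpow lq (- h2) + qpow lq (- l2)) * t1 + (qpow lq (- h1) + qpow lq (- l1)) * t2) * x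
            + p * (qpow lq (1/2) + qpow lq (- 1/2)) * t1 * t2) * f (q * z1) (q * z2) = 0"
  proof (rule degree_two_relation_proportional[OF q_nonzero x0 _ _ _ _ _ u u _ _ _ _ _ _ z f_eq[OF zD]])
    \<comment> \<open>Each relation between powers of \<open>q\<close> is a linear identity between exponents.\<close>
    show "b * b' * qpow lq \<alpha>2 = qpow lq \<alpha>1 * q"
      unfolding b b' lam qq qpow_add [symmetric] by (rule arg_cong[of _ _ "qpow lq"]) (simp add: field_simps)
    show "b' * qpow lq (h1 + 1/2) = a * qpow lq (l1 + 1/2)"
      "b * qpow lq (h2 + 1/2) = a * qpow lq (l2 + 1/2)"
      unfolding a b b' qpow_add [symmetric] by (simp_all add: algebra_simps)
    show "qpow lq \<alpha>1 * a * qpow lq (l1 + 1/2) = b * b' * (p * qpow lq (- l2))"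
      "qpow lq \<alpha>1 * b * qpow lq (l1 + 1/2) = b * b' * (p * qpow lq (- h2))"
      "qpow lq \<alpha>1 * a * qpow lq (l2 + 1/2) = b * b' * (p * qpow lq (- l1))"
      "qpow lq \<alpha>1 * b' * qpow lq (l2 + 1/2) = b * b' * (p * qpow lq (- h1))"
      "qpow lq \<alpha>1 * a * qpow lq (l1 + 1/2) * qpow lq (l2 + 1/2) = b * b' * (p * qpow lq (1/2))"
      unfolding a b b' p lam qpow_add [symmetric]
      by (rule arg_cong[of _ _ "qpow lq"], simp add: field_simps)+
    show "qpow lq (1/2) = q * qpow lq (- 1/2)"
      using u[of 0] by simp
  qed (simp_all add: b b')
  show "(x - qpow lq (h1 + 1/2) * t1) * (x - qpow lq (h2 + 1/2) * t2) * g (x / q)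
        + qpow lq (\<alpha>1 + \<alpha>2) * (x - qpow lq (l1 - 1/2) * t1) * (x - qpow lq (l2 - 1/2) * t2)
            * g (q * x)
        - ((qpow lq \<alpha>1 + qpow lq \<alpha>2) * x^2 + E * x
            + p * (qpow lq (1/2) + qpow lq (- 1/2)) * t1 * t2) * g x = 0"
    using rel \<alpha> unfolding g_at E by algebra
qed

end
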